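(* $(\mathcal{G},+)$, $(\mathcal{G},\cdot)$, $(\mathcal{G}_0,\cdot)$, $(\mathcal{A},+)$, $(\mathcal{M},\cdot)$, $(\mathcal{I},\cdot)$ and $(\mathcal{I}_0,\cdot)$ are commutative monoids. Moreover, $(\mathcal{G}_0,+)$ is a subsemigroup of $(\mathcal{G},+)$, $(\mathcal{A}_0,+)$ is a subsemigroup of $(\mathcal{A},+)$, $(\mathcal{M}_1,\cdot)$ is a subsemigroup of $(\mathcal{M},\cdot)$, and $(\mathcal{I}_{01},\cdot)$ is a subsemigroup of $(\mathcal{I},\cdot)$ and of $(\mathcal{I}_0,\cdot)$.
   Context: $\mathbb{N}$ is the set of positive integers. Arithmetic functions are functions $\mathbb{N}\to\mathbb{R}$; $+$ and $\cdot$ denote pointwise sum and product. $f$ is additive if $f(xy)=f(x)+f(y)$ for all coprime $x,y\in\mathbb{N}$; $g$ is multiplicative if $g$ is not identically zero and $g(xy)=g(x)g(y)$ for all coprime $x,y\in\mathbb{N}$. (So $f(1)=0$ for additive $f$ and $g(1)=1$ for multiplicative $g$.) In the following sets, the inequalities are required for all $x\in\mathbb{N}$ with $x>1$: $\mathcal{G}=\{f:\mathbb{N}\to\mathbb{R}: f(1)=0,\ f(x)\ge0\}$, $\mathcal{G}_0=\{f\in\mathcal{G}: f(x)>0\}$; $\mathcal{A}=\{f\text{ additive}: f(x)\ge0\}$, $\mathcal{A}_0=\{f\in\mathcal{A}: f(x)>0\}$; $\mathcal{M}=\{g\text{ multiplicative}: g(x)\ge1\}$, $\mathcal{M}_1=\{g\in\mathcal{M}: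 g(x)>1\}$; $\mathcal{I}=\{h\text{ multiplicative}: 0\le h(x)\le1\}$, $\mathcal{I}_0=\{h\in\mathcal{I}: 0<h(x)\le1\}$, $\mathcal{I}_{01}=\{h\in\mathcal{I}: 0<h(x)<1\}$. *)

theory Defs
  imports Complex_Main "HOL-Algebra.Group"
begin

text \<open>Arithmetic functions have the positive integers as domain. They are represented by
  functions on \<^typ>\<open>nat\<close> that take the value \<^term>\<open>undefined\<close> at 0, so that two of them
  are equal iff they agree on the positive integers; the operations are restricted accordingly.\<close>

definition arith_funs :: "(nat \<Rightarrow> real) set" where
  "arith_funs = {0<..} \<rightarrow>\<^sub>E UNIV"

definition add_fun :: "(nat \<Rightarrow> real) \<Rightarrow> (nat \<Rightarrow> real) \<Rightarrow> nat \<Rightarrow> real" where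
  "add_fun f g = (\<lambda>x\<in>{0<..}. f x + g x)"

definition mult_fun :: "(nat \<Rightarrow> real) \<Rightarrow> (nat \<Rightarrow> real) \<Rightarrow> nat \<Rightarrow> real" where
  "mult_fun f g = (\<lambda>x\<in>{0<..}. f x * g x)"

definition additive_fun :: "(nat \<Rightarrow> real) \<Rightarrow> bool" where
  "additive_fun f \<longleftrightarrow> f \<in> arith_funs \<and>
     (\<forall>x>0. \<forall>y>0. coprime x y \<longrightarrow> f (x * y) = f x + f y)"

definition multiplicative_fun :: "(nat \<Rightarrow> real) \<Rightarrow> bool" where
  "multiplicative_fun g \<longleftrightarrow> g \<in> arith_funs \<and> (\<exists>x>0. g x \<noteq> 0) \<and>
     (\<forall>x>0. \<forall>y>0. coprime x y \<longrightarrow> g (x * y) = g x * g y)"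

definition \<G> :: "(nat \<Rightarrow> real) set" where
  "\<G> = {f \<in> arith_funs. f 1 = 0 \<and> (\<forall>x>1. f x \<ge> 0)}"

definition \<G>\<^sub>0 :: "(nat \<Rightarrow> real) set" where
  "\<G>\<^sub>0 = {f \<in> \<G>. \<forall>x>1. f x > 0}"

definition \<A> :: "(nat \<Rightarrow> real) set" where
  "\<A> = {f. additive_fun f \<and> (\<forall>x>1. f x \<ge> 0)}"

definition \<A>\<^sub>0 :: "(nat \<Rightarrow> real) set" where
  "\<A>\<^sub>0 = {f \<in> \<A>. \<forall>x>1. f x > 0}"

definition \<M> :: "(nat \<Rightarrow> real) set" where
  "\<M> = {g. multiplicative_fun g \<and> (\<forall>x>1. g x \<ge> 1)}"

definition \<M>\<^sub>1 :: "(nat \<Rightarrow> real) set" where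
  "\<M>\<^sub>1 = {g \<in> \<M>. \<forall>x>1. g x > 1}"

definition \<I> :: "(nat \<Rightarrow> real) set" where
  "\<I> = {h. multiplicative_fun h \<and> (\<forall>x>1. 0 \<le> h x \<and> h x \<le> 1)}"

definition \<I>\<^sub>0 :: "(nat \<Rightarrow> real) set" where
  "\<I>\<^sub>0 = {h \<in> \<I>. \<forall>x>1. 0 < h x \<and> h x \<le> 1}"

definition \<I>\<^sub>0\<^sub>1 :: "(nat \<Rightarrow> real) set" where
  "\<I>\<^sub>0\<^sub>1 = {h \<in> \<I>. \<forall>x>1. 0 < h x \<and> h x < 1}"

text \<open>A pair (set, operation) is a commutative monoid if some element serves as the identity;
  note that the identity of \<^term>\<open>\<G>\<close> under the product is not the constant function 1.\<close>

definition is_comm_monoid :: "'a set \<Rightarrow> ('a \<Rightarrow> 'a \<Rightarrow> 'a) \<Rightarrow> bool" where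
  "is_comm_monoid S f \<longleftrightarrow> (\<exists>e. comm_monoid \<lparr>carrier = S, mult = f, one = e\<rparr>)"

text \<open>Semigroups, hence subsemigroups, are nonempty by convention.\<close>

definition is_semigroup :: "'a set \<Rightarrow> ('a \<Rightarrow> 'a \<Rightarrow> 'a) \<Rightarrow> bool" where
  "is_semigroup S f \<longleftrightarrow> S \<noteq> {} \<and> (\<forall>x\<in>S. \<forall>y\<in>S. f x y \<in> S) \<and>
     (\<forall>x\<in>S. \<forall>y\<in>S. \<forall>z\<in>S. f (f x y) z = f x (f y z))"

definition is_subsemigroup :: "'a set \<Rightarrow> 'a set \<Rightarrow> ('a \<Rightarrow> 'a \<Rightarrow> 'a) \<Rightarrow> bool" where
  "is_subsemigroup T S f \<longleftrightarrow> is_semigroup S f \<and> T \<subseteq> S \<and> is_semigroup T f"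

end

theory Submission
  imports Defs
begin

text \<open>Both operations are pointwise, so associativity and commutativity come from the real
  numbers; what remains is closure, a neutral element for each monoid and a member of each
  subsemigroup. Closure combines sign facts about sums and products of reals with
  \<open>additive_fun_add_fun\<close> and \<open>multiplicative_fun_mult_fun\<close>. The neutral
  element is the zero function for sums and the constant 1 for products of multiplicative functions;
  in \<open>\<G>\<close> and \<open>\<G>\<^sub>0\<close>, whose members vanish at 1, the product has
  the indicator of x > 1 as neutral element. The subsemigroups are inhabited by this indicator, ln
  x, x and 1/x.\<close>

lemma add_fun_apply [simp]: "x > 0 \<Longrightarrow> add_fun f g x = f x + g x"
  by (simp add: add_fun_def)

lemma mult_fun_apply [simp]: "x > 0 \<Longrightarrow> mult_fun f g x = f x * g x"
  by (simp add: mult_fun_def)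

lemma add_fun_arith [simp]: "add_fun f g \<in> arith_funs"
  by (simp add: add_fun_def arith_funs_def)

lemma mult_fun_arith [simp]: "mult_fun f g \<in> arith_funs"
  by (simp add: mult_fun_def arith_funs_def)

lemma restrict_arith [simp]: "restrict f {0<..} \<in> arith_funs"
  by (simp add: arith_funs_def)

lemma arith_funs_eqI:
  assumes "f \<in> arith_funs" "g \<in> arith_funs" "\<And>x. x > 0 \<Longrightarrow> f x = g x"
  shows "f = g"
  using assms unfolding arith_funs_def by (intro PiE_ext) auto

text \<open>No membership hypothesis is needed: the operation restricts its result to positive
  arguments, so both sides lie in \<open>arith_funs\<close> whatever \<open>f\<close> and
  \<open>g\<close> are.\<close>

lemma add_fun_commute: "add_fun f g = add_fun g f"
  by (rule arith_funs_eqI) auto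

lemma mult_fun_commute: "mult_fun f g = mult_fun g f"
  by (rule arith_funs_eqI) auto

lemma add_fun_assoc: "add_fun (add_fun f g) h = add_fun f (add_fun g h)"
  by (rule arith_funs_eqI) auto

lemma mult_fun_assoc: "mult_fun (mult_fun f g) h = mult_fun f (mult_fun g h)"
  by (rule arith_funs_eqI) auto

lemma is_comm_monoidI:
  assumes "e \<in> S" "\<And>f g. f \<in> S \<Longrightarrow> g \<in> S \<Longrightarrow> m f g \<in> S"
    and "\<And>f g h. m (m f g) h = m f (m g h)" "\<And>f g. m f g = m g f"
    and "\<And>f. f \<in> S \<Longrightarrow> m e f = f"
  shows "is_comm_monoid S m"
  unfolding is_comm_monoid_def
  by (rule exI[of _ e], rule comm_monoidI) (use assms in auto)

lemma is_comm_monoid_add_fun: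
  assumes "S \<subseteq> arith_funs" "e \<in> S" "\<And>x. x > 0 \<Longrightarrow> e x = 0"
    and "\<And>f g. f \<in> S \<Longrightarrow> g \<in> S \<Longrightarrow> add_fun f g \<in> S"
  shows "is_comm_monoid S add_fun"
proof (rule is_comm_monoidI[of e])
  show "add_fun e f = f" if "f \<in> S" for f
    using that assms(1,3) by (intro arith_funs_eqI) auto
qed (use assms in \<open>auto simp: add_fun_assoc intro: add_fun_commute\<close>)

text \<open>The unit law is imposed only on values of members of \<open>S\<close>. Requiring
  \<open>e\<close> to be constantly 1 would exclude \<open>\<G>\<close> and
  \<open>\<G>\<^sub>0\<close>.\<close>

lemma is_comm_monoid_mult_fun:
  assumes "S \<subseteq> arith_funs" "e \<in> S" "\<And>f x. f \<in> S \<Longrightarrow> x > 0 \<Longrightarrow> e x * f x = f x"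
    and "\<And>f g. f \<in> S \<Longrightarrow> g \<in> S \<Longrightarrow> mult_fun f g \<in> S"
  shows "is_comm_monoid S mult_fun"
proof (rule is_comm_monoidI[of e])
  show "mult_fun e f = f" if "f \<in> S" for f
    using that assms(1,3) by (intro arith_funs_eqI) auto
qed (use assms in \<open>auto simp: mult_fun_assoc intro: mult_fun_commute\<close>)

lemma is_comm_monoid_imp_semigroup: "is_comm_monoid S f \<Longrightarrow> is_semigroup S f"
proof -
  assume "is_comm_monoid S f"
  then obtain e where "comm_monoid \<lparr>carrier = S, mult = f, one = e\<rparr>"
    unfolding is_comm_monoid_def by blast
  then interpret comm_monoid "\<lparr>carrier = S, mult = f, one = e\<rparr>" .
  show ?thesis
    unfolding is_semigroup_def using one_closed m_closed m_assoc by auto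
qed

text \<open>Associativity on \<open>T\<close> is inherited from \<open>S\<close>; \<open>e\<close>
  serves only to show that \<open>T\<close> is nonempty and need not be neutral.\<close>

lemma is_subsemigroupI:
  assumes "is_comm_monoid S f" "T \<subseteq> S" "e \<in> T"
    and "\<And>x y. x \<in> T \<Longrightarrow> y \<in> T \<Longrightarrow> f x y \<in> T"
  shows "is_subsemigroup T S f"
  using is_comm_monoid_imp_semigroup[OF assms(1)] assms(2-4)
  unfolding is_subsemigroup_def is_semigroup_def by (meson empty_iff subsetD)

text \<open>Cancel a nonzero value \<open>g x\<close> in g(x * 1) = g(x) g(1).\<close>

lemma multiplicative_fun_one:
  assumes "multiplicative_fun g"
  shows "g 1 = 1"
proof -
  from assms obtain x where x: "x > 0" "g x \<noteq> 0"
    by (auto simp: multiplicative_fun_def)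
  from assms x(1) have "g (x * 1) = g x * g 1"
    unfolding multiplicative_fun_def by (metis coprime_1_right zero_less_one)
  with x(2) show ?thesis by simp
qed

lemma additive_fun_add_fun:
  "additive_fun f \<Longrightarrow> additive_fun g \<Longrightarrow> additive_fun (add_fun f g)"
  by (simp add: additive_fun_def)

text \<open>The delicate point is that the product is not identically zero, since nonzero functions
  may have disjoint supports. Here both factors equal 1 at 1, so the product does not vanish
  there.\<close>

lemma multiplicative_fun_mult_fun:
  assumes "multiplicative_fun f" "multiplicative_fun g"
  shows "multiplicative_fun (mult_fun f g)"
proof -
  have "mult_fun f g 1 \<noteq> 0"
    using assms by (simp add: multiplicative_fun_one[simplified])
  then show ?thesis
    using assms unfolding multiplicative_fun_def
    by (auto intro: exI[of _ 1])
qed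

lemma additive_fun_restrict:
  "additive_fun (restrict f {0<..})"
  if "\<And>x y. x > 0 \<Longrightarrow> y > 0 \<Longrightarrow> f (x * y) = f x + f y"
  using that by (simp add: additive_fun_def)

text \<open>Coprimality is dropped from the premise because the functions it is applied to (1, x and
  1/x) are completely multiplicative.\<close>

lemma multiplicative_fun_restrict:
  "multiplicative_fun (restrict f {0<..})"
  if "f 1 \<noteq> 0" "\<And>x y. x > 0 \<Longrightarrow> y > 0 \<Longrightarrow> f (x * y) = f x * f y"
  using that by (auto simp: multiplicative_fun_def intro: exI[of _ 1])

lemma is_comm_monoid_\<G>_add: "is_comm_monoid \<G> add_fun"
  by (rule is_comm_monoid_add_fun[where e = "\<lambda>x\<in>{0<..}. 0"]) (auto simp: \<G>_def)

lemma is_comm_monoid_\<G>_mult: "is_comm_monoid \<G> mult_fun"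
  by (rule is_comm_monoid_mult_fun[where e = "\<lambda>x\<in>{0<..}. if x = 1 then 0 else 1"])
    (auto simp: \<G>_def)

lemma is_comm_monoid_\<G>\<^sub>0_mult: "is_comm_monoid \<G>\<^sub>0 mult_fun"
  by (rule is_comm_monoid_mult_fun[where e = "\<lambda>x\<in>{0<..}. if x = 1 then 0 else 1"])
    (auto simp: \<G>\<^sub>0_def \<G>_def)

lemma is_comm_monoid_\<A>: "is_comm_monoid \<A> add_fun"
proof (rule is_comm_monoid_add_fun[where e = "\<lambda>x\<in>{0<..}. 0"])
  show "\<A> \<subseteq> arith_funs" by (auto simp: \<A>_def additive_fun_def)
qed (auto simp: \<A>_def additive_fun_add_fun additive_fun_restrict)

lemma is_comm_monoid_\<M>: "is_comm_monoid \<M> mult_fun"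
proof (rule is_comm_monoid_mult_fun[where e = "\<lambda>x\<in>{0<..}. 1"])
  show "\<M> \<subseteq> arith_funs" by (auto simp: \<M>_def multiplicative_fun_def)
  show "mult_fun f g \<in> \<M>" if "f \<in> \<M>" "g \<in> \<M>" for f g
    \<comment> \<open>This instance yields 1 * 1 \<le> f(x) g(x) once both factors are at least
      1.\<close>
    using that mult_mono[of 1 "f x" 1 "g x" for x]
    by (fastforce simp: \<M>_def multiplicative_fun_mult_fun)
qed (auto simp: \<M>_def multiplicative_fun_restrict)

lemma is_comm_monoid_\<I>: "is_comm_monoid \<I> mult_fun"
proof (rule is_comm_monoid_mult_fun[where e = "\<lambda>x\<in>{0<..}. 1"])
  show "\<I> \<subseteq> arith_funs" by (auto simp: \<I>_def multiplicative_fun_def)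
qed (auto simp: \<I>_def multiplicative_fun_restrict multiplicative_fun_mult_fun mult_le_one)

lemma is_comm_monoid_\<I>\<^sub>0: "is_comm_monoid \<I>\<^sub>0 mult_fun"
proof (rule is_comm_monoid_mult_fun[where e = "\<lambda>x\<in>{0<..}. 1"])
  show "\<I>\<^sub>0 \<subseteq> arith_funs" by (auto simp: \<I>\<^sub>0_def \<I>_def multiplicative_fun_def)
qed (auto simp: \<I>\<^sub>0_def \<I>_def multiplicative_fun_restrict multiplicative_fun_mult_fun mult_le_one)

lemma inverse_in_\<I>\<^sub>0\<^sub>1: "(\<lambda>x\<in>{0<..}. 1 / real x) \<in> \<I>\<^sub>0\<^sub>1"
  by (auto simp: \<I>\<^sub>0\<^sub>1_def \<I>_def intro!: multiplicative_fun_restrict)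

lemma mult_fun_in_\<I>\<^sub>0\<^sub>1:
  assumes "f \<in> \<I>\<^sub>0\<^sub>1" "g \<in> \<I>\<^sub>0\<^sub>1"
  shows "mult_fun f g \<in> \<I>\<^sub>0\<^sub>1"
proof -
  have "f x * g x < 1" if "x > 1" for x
    using assms that mult_strict_mono[of "f x" 1 "g x" 1] by (auto simp: \<I>\<^sub>0\<^sub>1_def less_imp_le)
  with assms show ?thesis
    by (auto simp: \<I>\<^sub>0\<^sub>1_def \<I>_def multiplicative_fun_mult_fun less_imp_le)
qed

theorem lemma3p4:
  "is_comm_monoid \<G> add_fun \<and>
   is_comm_monoid \<G> mult_fun \<and>
   is_comm_monoid \<G>\<^sub>0 mult_fun \<and>
   is_comm_monoid \<A> add_fun \<and>
   is_comm_monoid \<M> mult_fun \<and>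
   is_comm_monoid \<I> mult_fun \<and>
   is_comm_monoid \<I>\<^sub>0 mult_fun \<and>
   is_subsemigroup \<G>\<^sub>0 \<G> add_fun \<and>
   is_subsemigroup \<A>\<^sub>0 \<A> add_fun \<and>
   is_subsemigroup \<M>\<^sub>1 \<M> mult_fun \<and>
   is_subsemigroup \<I>\<^sub>0\<^sub>1 \<I> mult_fun \<and>
   is_subsemigroup \<I>\<^sub>0\<^sub>1 \<I>\<^sub>0 mult_fun"
proof (intro conjI)
  show "is_subsemigroup \<G>\<^sub>0 \<G> add_fun"
    by (rule is_subsemigroupI[OF is_comm_monoid_\<G>_add,
          where e = "\<lambda>x\<in>{0<..}. if x = 1 then 0 else 1"])
      (auto simp: \<G>\<^sub>0_def \<G>_def add_pos_pos)
  show "is_subsemigroup \<A>\<^sub>0 \<A> add_fun"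
    \<comment> \<open>The logarithm turns products into sums and is positive beyond 1.\<close>
    by (rule is_subsemigroupI[OF is_comm_monoid_\<A>, where e = "\<lambda>x\<in>{0<..}. ln (real x)"])
      (auto simp: \<A>\<^sub>0_def \<A>_def ln_mult add_pos_pos
        intro!: additive_fun_add_fun additive_fun_restrict)
  show "is_subsemigroup \<M>\<^sub>1 \<M> mult_fun"
    \<comment> \<open>The embedding of the naturals into the reals is completely multiplicative and
      exceeds 1 beyond 1.\<close>
    by (rule is_subsemigroupI[OF is_comm_monoid_\<M>, where e = "\<lambda>x\<in>{0<..}. real x"])
      (auto simp: \<M>\<^sub>1_def \<M>_def less_1_mult less_imp_le
        intro!: multiplicative_fun_mult_fun multiplicative_fun_restrict)
  show "is_subsemigroup \<I>\<^sub>0\<^sub>1 \<I> mult_fun"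
    by (rule is_subsemigroupI[OF is_comm_monoid_\<I> _ inverse_in_\<I>\<^sub>0\<^sub>1 mult_fun_in_\<I>\<^sub>0\<^sub>1])
      (auto simp: \<I>\<^sub>0\<^sub>1_def)
  show "is_subsemigroup \<I>\<^sub>0\<^sub>1 \<I>\<^sub>0 mult_fun"
    by (rule is_subsemigroupI[OF is_comm_monoid_\<I>\<^sub>0 _ inverse_in_\<I>\<^sub>0\<^sub>1 mult_fun_in_\<I>\<^sub>0\<^sub>1])
      (auto simp: \<I>\<^sub>0\<^sub>1_def \<I>\<^sub>0_def less_imp_le)
qed (fact is_comm_monoid_\<G>_add is_comm_monoid_\<G>_mult is_comm_monoid_\<G>\<^sub>0_mult
      is_comm_monoid_\<A> is_comm_monoid_\<M> is_comm_monoid_\<I> is_comm_monoid_\<I>\<^sub>0)+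

end
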